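(* There exists a constant $C > 0$ such that for all integers $n \geq 3$, there exists an $n\times n$ nonnegative matrix $M$ such that \[ \frac{\mathrm{rk}_+(M)}{\mathrm{rk}(M)} \geq n^{1 - C\sqrt{\frac{\log\log n}{\log n}}}. \]
   Context: $\log$ denotes the logarithm in base 2. A real matrix is nonnegative if all of its entries are nonnegative. The nonnegative rank $\mathrm{rk}_+(M)$ of a nonnegative matrix $M$ is the minimum $r$ for which there exist nonnegative matrices $W_1,\dots,W_r$, each of rank one, such that $M=\sum_{i=1}^r W_i$. $\mathrm{rk}(M)$ is the usual rank of $M$ over the reals (the matrix $M$ in the claim is nonzero, so that the ratio makes sense). *)

theory Defs
  imports "HOL-Analysis.Analysis" "Jordan_Normal_Form.DL_Rank"
begin

(* HOL-Analysis has its own constant "rank" for matrices whose dimensions are types, hence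
   the separate name. vec_space.rank needs the length of the column vectors as an argument. *)
definition mat_rank :: "real mat \<Rightarrow> nat" where
  "mat_rank A = vec_space.rank (dim_row A) A"

definition nonneg_mat :: "real mat \<Rightarrow> bool" where
  "nonneg_mat A \<longleftrightarrow> (\<forall>i<dim_row A. \<forall>j<dim_col A. 0 \<le> A $$ (i, j))"

(* Matrices of varying size do not form a monoid type, so the sum of the W k is written entrywise. *)
definition nonneg_rank_one_decomp :: "real mat \<Rightarrow> nat \<Rightarrow> (nat \<Rightarrow> real mat) \<Rightarrow> bool" where
  "nonneg_rank_one_decomp M r W \<longleftrightarrow>
     (\<forall>k<r. W k \<in> carrier_mat (dim_row M) (dim_col M) \<and> nonneg_mat (W k) \<and> mat_rank (W k) = 1) \<and>
     M = mat (dim_row M) (dim_col M) (\<lambda>(i, j). \<Sum>k<r. W k $$ (i, j))"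

(* Meant for nonnegative M only: such an M is the sum of its nonzero entries, each placed in an
   otherwise zero matrix, so the minimum is over a nonempty set. *)
definition nonneg_rank :: "real mat \<Rightarrow> nat" where
  "nonneg_rank M = (LEAST r. \<exists>W. nonneg_rank_one_decomp M r W)"

end

theory Submission
  imports Defs
begin

text \<open>The matrix with entries \<open>(1 - card (a \<inter> b))\<^sup>2\<close>, for subsets \<open>a\<close>, \<open>b\<close> of an \<open>m\<close>-element set, has rank
polynomial in \<open>m\<close>, being the square of an inner product of short vectors. Its nonnegative rank is at
least \<open>(3/2) ^ m\<close>: the supports of the summands in a nonnegative decomposition are rectangles that avoid
the zeros of the matrix, that is, the pairs meeting in exactly one point; such a rectangle contains
at most \<open>2 ^ m\<close> of the \<open>3 ^ m\<close> disjoint pairs. This is a power of the size \<open>2 ^ m\<close>, with exponent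
below 1.

The exponent is pushed towards 1 by a larger alphabet. Sets become words of length \<open>m\<close> over \<open>q = 2 ^ p\<close>
letters, and \<open>a \<inter> b\<close> becomes the set of positions where the two letters conflict, that is, form a pair
outside a fixed relation \<open>Z\<close> on the letters. The rank is still at most \<open>(1 + m * q)\<^sup>2\<close>, whatever \<open>Z\<close> is,
because the conflict at one position depends on \<open>q\<close> indicators. There are \<open>(card Z) ^ m\<close> conflict-free
pairs. If all grids inside \<open>Z\<close> have a side of length at most \<open>l\<close>, a rectangle without pairs of exactly
one conflict has at most \<open>(2 * l * q) ^ m\<close> conflict-free pairs (\<open>card_conflict_free_in_rectangle_le\<close>, the
heart of the proof). A counting argument (\<open>bipartite_ramsey\<close>) gives a \<open>Z\<close> with at least half of all pairs
and \<open>l = 2 * p\<close>. So the nonnegative rank is at least \<open>(q / (8 * p)) ^ m\<close>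
(\<open>mat_with_small_rank_large_nonneg_rank\<close>), which falls short of the size \<open>q ^ m\<close> only by the factor
\<open>(8 * p) ^ m\<close>.

With \<open>L = log 2 n\<close> and \<open>m \<approx> L / p\<close>, the losses are \<open>2 ^ O(p)\<close> from the rank and from padding to size
\<open>n\<close>, and \<open>2 ^ O(L / p * log 2 L)\<close> from the covering argument. For \<open>p \<approx> sqrt (L * log 2 L)\<close> both are
\<open>2 ^ O(sqrt (L * log 2 L))\<close>, which is the claimed \<open>n ^ O(sqrt (log 2 L / L))\<close> (\<open>exponent_loss_le\<close>).\<close>

section \<open>Rank, supports and nonnegative rank\<close>

text \<open>Independence of a few columns is phrased through the kernel of the matrix that they form, so that
below it can be read off by looking at two entries.\<close>

lemma mat_rank_ge_length:
  assumes A: "A \<in> carrier_mat n nc" and sub: "set cs \<subseteq> set (cols A)" and "distinct cs"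
    and indep: "\<And>v. v \<in> carrier_vec (length cs) \<Longrightarrow> mat_of_cols n cs *\<^sub>v v = 0\<^sub>v n \<Longrightarrow> v = 0\<^sub>v (length cs)"
  shows "length cs \<le> mat_rank A"
proof -
  interpret vec_space "TYPE(real)" n .
  have cs: "set cs \<subseteq> carrier_vec n"
    using sub A cols_dim by blast
  have cols: "cols (mat_of_cols n cs) = cs"
    using cs by (rule cols_mat_of_cols)
  have "lin_indpt (set cs)"
  proof
    assume "lin_dep (set cs)"
    then obtain v where "v \<in> carrier_vec (length cs)" "v \<noteq> 0\<^sub>v (length cs)"
      "mat_of_cols n cs *\<^sub>v v = 0\<^sub>v n"
      using lin_depE[of "mat_of_cols n cs" "length cs"] cols \<open>distinct cs\<close> by auto
    then show False using indep by blast
  qed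
  then have "card (set cs) \<le> rank A"
    using rank_ge_card_indpt[OF A sub] by simp
  then show ?thesis
    using A \<open>distinct cs\<close> by (simp add: mat_rank_def distinct_card)
qed

lemma mat_rank_pos:
  assumes A: "A \<in> carrier_mat n nc" and ij: "i < n" "j < nc" and nz: "A $$ (i, j) \<noteq> 0"
  shows "mat_rank A \<ge> 1"
proof -
  have "length [col A j] \<le> mat_rank A"
  proof (rule mat_rank_ge_length[OF A])
    fix v :: "real vec"
    assume v: "v \<in> carrier_vec (length [col A j])" and eq: "mat_of_cols n [col A j] *\<^sub>v v = 0\<^sub>v n"
    have "(mat_of_cols n [col A j] *\<^sub>v v) $ i = A $$ (i, j) * v $ 0"
      using A ij v by (simp add: scalar_prod_def mat_of_cols_index)
    then have "v $ 0 = 0"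
      using eq nz ij by simp
    then show "v = 0\<^sub>v (length [col A j])"
      using v by auto
  qed (use A ij in \<open>auto simp: cols_def\<close>)
  then show ?thesis by simp
qed

text \<open>If the entry at \<open>(i, j')\<close> vanished, rows \<open>i\<close> and \<open>i'\<close> would show columns \<open>j\<close> and \<open>j'\<close> in triangular
form with nonzero diagonal, and the rank would be at least two.\<close>

lemma rank_one_support_rectangle:
  assumes A: "A \<in> carrier_mat n nc" and rk: "mat_rank A = 1"
    and ij: "i < n" "i' < n" "j < nc" "j' < nc"
    and nz: "A $$ (i, j) \<noteq> 0" "A $$ (i', j') \<noteq> 0"
  shows "A $$ (i, j') \<noteq> 0"
proof
  assume z: "A $$ (i, j') = 0"
  let ?cs = "[col A j, col A j']"
  have "length ?cs \<le> mat_rank A"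
  proof (rule mat_rank_ge_length[OF A])
    have "col A j $ i \<noteq> col A j' $ i"
      using A ij nz z by simp
    then show "distinct ?cs" by auto
  next
    fix v :: "real vec"
    assume v: "v \<in> carrier_vec (length ?cs)" and eq: "mat_of_cols n ?cs *\<^sub>v v = 0\<^sub>v n"
    have row: "A $$ (k, j) * v $ 0 + A $$ (k, j') * v $ 1 = 0" if "k < n" for k
    proof -
      have "(mat_of_cols n ?cs *\<^sub>v v) $ k = A $$ (k, j) * v $ 0 + A $$ (k, j') * v $ 1"
        using A ij v that by (simp add: scalar_prod_def mat_of_cols_index)
      then show ?thesis using eq that by simp
    qed
    have "v $ 0 = 0" using row[of i] ij nz z by simp
    moreover from this have "v $ 1 = 0" using row[of i'] ij nz by simp
    ultimately show "v = 0\<^sub>v (length ?cs)"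
      using v by (auto simp: less_Suc_eq)
  qed (use A ij in \<open>auto simp: cols_def\<close>)
  then show False using rk by simp
qed

lemma mat_rank_sum_products_le:
  fixes u v :: "'k \<Rightarrow> nat \<Rightarrow> real"
  assumes "finite K"
  shows "mat_rank (mat n nc (\<lambda>(i, j). \<Sum>k\<in>K. u k i * v k j)) \<le> card K"
  using assms
proof (induction K)
  case empty
  have "mat n nc (\<lambda>(i, j). \<Sum>k\<in>{}. u k i * v k j) = (0\<^sub>m n nc :: real mat)"
    by auto
  then show ?case
    using vec_space.rank_0I[of n nc, where 'a=real] by (simp only: mat_rank_def) simp
next
  case (insert k K)
  let ?A = "mat n nc (\<lambda>(i, j). u k i * v k j)"
  let ?B = "mat n nc (\<lambda>(i, j). \<Sum>k\<in>K. u k i * v k j)"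
  have "mat n nc (\<lambda>(i, j). \<Sum>k\<in>insert k K. u k i * v k j) = ?A + ?B"
    using insert by auto
  moreover have "vec_space.rank n (?A + ?B) \<le> vec_space.rank n ?A + vec_space.rank n ?B"
    by (rule vec_space.rank_subadditive) auto
  moreover have "vec_space.rank n ?A \<le> 1"
    by (rule vec_space.rank_le_1_product_entries) auto
  ultimately show ?case
    using insert by (simp add: mat_rank_def)
qed

text \<open>The nonzero columns of \<open>M\<close>, each placed in an otherwise zero matrix, form a decomposition. So the
minimum in the definition of the nonnegative rank is attained.\<close>

lemma nonneg_rank_one_decomp_exists:
  assumes M: "nonneg_mat M"
  shows "\<exists>r W. nonneg_rank_one_decomp M r W"
proof -
  let ?n = "dim_row M" and ?m = "dim_col M"
  define J where "J = {j. j < ?m \<and> (\<exists>i<?n. M $$ (i, j) \<noteq> 0)}"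
  have "finite J" by (simp add: J_def)
  then obtain e where e: "bij_betw e {..<card J} J"
    using ex_bij_betw_nat_finite[of J] by (auto simp: atLeast0LessThan)
  define W where "W k = mat ?n ?m (\<lambda>(i, j). M $$ (i, j) * of_bool (j = e k))" for k
  have "nonneg_rank_one_decomp M (card J) W"
    unfolding nonneg_rank_one_decomp_def
  proof (intro conjI allI impI)
    fix k assume "k < card J"
    then have "e k \<in> J" using e by (auto simp: bij_betw_def)
    then obtain i where i: "i < ?n" "e k < ?m" "M $$ (i, e k) \<noteq> 0" by (auto simp: J_def)
    show "W k \<in> carrier_mat ?n ?m" by (simp add: W_def)
    show "nonneg_mat (W k)" using M by (simp add: W_def nonneg_mat_def)
    have "mat_rank (W k) \<ge> 1"
      by (rule mat_rank_pos[of _ ?n ?m i "e k"]) (use i in \<open>auto simp: W_def\<close>)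
    moreover have "vec_space.rank ?n (W k) \<le> 1"
      by (rule vec_space.rank_le_1_product_entries[of _ _ ?m "\<lambda>i. M $$ (i, e k)" "\<lambda>j. of_bool (j = e k)"])
         (auto simp: W_def)
    ultimately show "mat_rank (W k) = 1" by (simp add: mat_rank_def W_def)
  next
    show "M = mat ?n ?m (\<lambda>(i, j). \<Sum>k<card J. W k $$ (i, j))"
    proof (rule eq_matI)
      fix i j assume "i < dim_row (mat ?n ?m (\<lambda>(i, j). \<Sum>k<card J. W k $$ (i, j)))"
        "j < dim_col (mat ?n ?m (\<lambda>(i, j). \<Sum>k<card J. W k $$ (i, j)))"
      then have ij: "i < ?n" "j < ?m" by auto
      have "(\<Sum>k<card J. W k $$ (i, j)) = (\<Sum>k<card J. M $$ (i, j) * of_bool (j = e k))"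
        using ij by (simp add: W_def)
      also have "\<dots> = (\<Sum>l\<in>J. M $$ (i, j) * of_bool (j = l))"
        by (rule sum.reindex_bij_betw[OF e])
      also have "\<dots> = (if j \<in> J then M $$ (i, j) else 0)"
        using \<open>finite J\<close> by (simp add: of_bool_def if_distrib[of "(*) _"] cong: if_cong)
      also have "\<dots> = M $$ (i, j)" using ij by (auto simp: J_def)
      finally show "M $$ (i, j) = mat ?n ?m (\<lambda>(i, j). \<Sum>k<card J. W k $$ (i, j)) $$ (i, j)"
        using ij by simp
    qed auto
  qed
  then show ?thesis by blast
qed

text \<open>The rectangle covering bound. Nonnegative summands cannot cancel, so the support of each rank-one
summand lies in the support of \<open>M\<close>; it is a combinatorial rectangle, and these rectangles together
cover the support of \<open>M\<close>, hence \<open>D\<close>. If every rectangle inside the support catches few elements of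
\<open>D\<close>, many summands are needed.\<close>

lemma card_le_nonneg_rank_mult:
  assumes M: "nonneg_mat M" and D: "D \<subseteq> {..<dim_row M} \<times> {..<dim_col M}"
    and nz: "\<And>i j. (i, j) \<in> D \<Longrightarrow> M $$ (i, j) \<noteq> 0"
    and rect: "\<And>I J. I \<subseteq> {..<dim_row M} \<Longrightarrow> J \<subseteq> {..<dim_col M} \<Longrightarrow>
        (\<And>i j. i \<in> I \<Longrightarrow> j \<in> J \<Longrightarrow> M $$ (i, j) \<noteq> 0) \<Longrightarrow> card (D \<inter> I \<times> J) \<le> c"
  shows "card D \<le> nonneg_rank M * c"
proof -
  let ?n = "dim_row M" and ?m = "dim_col M" and ?r = "nonneg_rank M"
  have "\<exists>W. nonneg_rank_one_decomp M ?r W"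
    unfolding nonneg_rank_def using nonneg_rank_one_decomp_exists[OF M] by (rule LeastI_ex)
  then obtain W where W: "\<And>k. k < ?r \<Longrightarrow> W k \<in> carrier_mat ?n ?m"
      "\<And>k. k < ?r \<Longrightarrow> nonneg_mat (W k)" "\<And>k. k < ?r \<Longrightarrow> mat_rank (W k) = 1"
    and eq: "M = mat ?n ?m (\<lambda>(i, j). \<Sum>k<?r. W k $$ (i, j))"
    unfolding nonneg_rank_one_decomp_def by blast
  have sum: "M $$ (i, j) = (\<Sum>k<?r. W k $$ (i, j))" if "i < ?n" "j < ?m" for i j
    using that by (subst eq) simp
  have pos: "W k $$ (i, j) \<ge> 0" if "k < ?r" "i < ?n" "j < ?m" for k i j
    using W(1,2)[OF that(1)] that by (auto simp: nonneg_mat_def)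
  have M_nz_iff: "M $$ (i, j) \<noteq> 0 \<longleftrightarrow> (\<exists>k<?r. W k $$ (i, j) \<noteq> 0)" if "i < ?n" "j < ?m" for i j
  proof -
    have "(\<Sum>k<?r. W k $$ (i, j)) = 0 \<longleftrightarrow> (\<forall>k\<in>{..<?r}. W k $$ (i, j) = 0)"
      by (rule sum_nonneg_eq_0_iff) (use pos that in auto)
    then show ?thesis using sum[OF that] by auto
  qed
  define I where "I k = {i. i < ?n \<and> (\<exists>j<?m. W k $$ (i, j) \<noteq> 0)}" for k
  define J where "J k = {j. j < ?m \<and> (\<exists>i<?n. W k $$ (i, j) \<noteq> 0)}" for k
  have "D \<subseteq> (\<Union>k<?r. D \<inter> I k \<times> J k)"
  proof safe
    fix i j assume ij: "(i, j) \<in> D"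
    then have "i < ?n" "j < ?m" "M $$ (i, j) \<noteq> 0" using D nz by auto
    moreover from this obtain k where "k < ?r" "W k $$ (i, j) \<noteq> 0" using M_nz_iff by blast
    ultimately show "(i, j) \<in> (\<Union>k<?r. D \<inter> I k \<times> J k)"
      using ij by (auto simp: I_def J_def)
  qed
  moreover have "finite (D \<inter> X)" for X
    using finite_subset[OF D] by auto
  ultimately have "card D \<le> card (\<Union>k<?r. D \<inter> I k \<times> J k)"
    by (intro card_mono) auto
  also have "\<dots> \<le> (\<Sum>k<?r. card (D \<inter> I k \<times> J k))"
    by (rule card_UN_le) simp
  also have "\<dots> \<le> (\<Sum>k<?r. c)"
  proof (rule sum_mono)
    fix k assume "k \<in> {..<?r}"
    then have k: "k < ?r" by simp
    show "card (D \<inter> I k \<times> J k) \<le> c"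
    proof (rule rect)
      fix i j assume "i \<in> I k" "j \<in> J k"
      then obtain i' j' where "i < ?n" "j' < ?m" "W k $$ (i, j') \<noteq> 0"
          "j < ?m" "i' < ?n" "W k $$ (i', j) \<noteq> 0"
        by (auto simp: I_def J_def)
      then show "M $$ (i, j) \<noteq> 0"
        using rank_one_support_rectangle[OF W(1)[OF k] W(3)[OF k]] M_nz_iff k by blast
    qed (auto simp: I_def J_def)
  qed
  finally show ?thesis by simp
qed

section \<open>Words, conflicts and rectangles without a single conflict\<close>

text \<open>The number of positions at which the two words (always of equal length below) carry a pair of
letters outside \<open>Z\<close>. For words over two letters and \<open>Z\<close> the complement of \<open>{(1, 1)}\<close> this is the
size of the intersection of two sets.\<close>

fun conflicts :: "('a \<times> 'b) set \<Rightarrow> 'a list \<Rightarrow> 'b list \<Rightarrow> nat" where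
  "conflicts Z (x # xs) (y # ys) = of_bool ((x, y) \<notin> Z) + conflicts Z xs ys"
| "conflicts Z _ _ = 0"

definition words :: "'a set \<Rightarrow> nat \<Rightarrow> 'a list set" where
  "words X m = {xs. set xs \<subseteq> X \<and> length xs = m}"

lemma finite_words: "finite X \<Longrightarrow> finite (words X m)"
  by (simp add: words_def finite_lists_length_eq)

lemma card_words: "finite X \<Longrightarrow> card (words X m) = card X ^ m"
  by (simp add: words_def card_lists_length_eq)

lemma words_Suc: "words X (Suc m) = (\<lambda>(x, xs). x # xs) ` (X \<times> words X m)"
  by (force simp: words_def length_Suc_conv image_iff)

lemma Cons_in_words_iff: "x # xs \<in> words X (Suc m) \<longleftrightarrow> x \<in> X \<and> xs \<in> words X m"
  by (auto simp: words_def)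

text \<open>An extension to larger alphabets of the argument of Kaibel and Weltge for unique disjointness.
Strip the first letters. For a conflict-free pair \<open>(a, b)\<close> of tails, let \<open>S a\<close> and \<open>T b\<close> be the sets
of letters that may precede them. A pair of letters outside \<open>Z\<close> would create exactly one conflict, so
\<open>S a \<times> T b \<subseteq> Z\<close>, and one of the two sets has at most \<open>l\<close> elements. Therefore
\<open>card (S a) * card (T b) \<le> l * (card (S a) + card (T b))\<close>, and it suffices to bound the sums of
\<open>card (S a)\<close> and of \<open>card (T b)\<close> over the pairs of tails. For a fixed first letter \<open>x\<close>, the pairs of
tails with \<open>x \<in> S a\<close> all lie in the rectangle of tails \<open>a\<close> that follow \<open>x\<close> and tails \<open>b\<close> that follow
some \<open>y\<close> with \<open>(x, y) \<in> Z\<close>. Prefixing \<open>x\<close> and \<open>y\<close> adds no conflict, so no pair in this rectangle has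
exactly one conflict either, and the induction hypothesis applies to it.\<close>

lemma card_conflict_free_in_rectangle_le:
  fixes X :: "'a set" and Y :: "'b set"
  assumes fin: "finite X" "finite Y"
    and Z: "\<And>S T. S \<subseteq> X \<Longrightarrow> T \<subseteq> Y \<Longrightarrow> S \<times> T \<subseteq> Z \<Longrightarrow> card S \<le> l \<or> card T \<le> l"
    and "A \<subseteq> words X m" "B \<subseteq> words Y m"
    and "\<And>a b. a \<in> A \<Longrightarrow> b \<in> B \<Longrightarrow> conflicts Z a b \<noteq> 1"
  shows "card {(a, b) \<in> A \<times> B. conflicts Z a b = 0} \<le> (l * (card X + card Y)) ^ m"
  using assms(4-6)
proof (induction m arbitrary: A B)
  case 0
  then have "{(a, b) \<in> A \<times> B. conflicts Z a b = 0} \<subseteq> {([], [])}"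
    by (auto simp: words_def)
  then have "card {(a, b) \<in> A \<times> B. conflicts Z a b = 0} \<le> card {([] :: 'a list, [] :: 'b list)}"
    by (rule card_mono[rotated]) simp
  then show ?case by simp
next
  case (Suc m)
  let ?c = "(l * (card X + card Y)) ^ m"
  define S where "S a = {x. x # a \<in> A}" for a
  define T where "T b = {y. y # b \<in> B}" for b
  define D where "D = {(a, b) \<in> words X m \<times> words Y m. conflicts Z a b = 0 \<and> S a \<noteq> {} \<and> T b \<noteq> {}}"
  have S_sub: "S a \<subseteq> X" for a using Suc.prems(1) by (auto simp: S_def Cons_in_words_iff)
  have T_sub: "T b \<subseteq> Y" for b using Suc.prems(2) by (auto simp: T_def Cons_in_words_iff)
  note finS = finite_subset[OF S_sub fin(1)] and finT = finite_subset[OF T_sub fin(2)]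
  have finD: "finite D"
    unfolding D_def by (rule finite_subset[of _ "words X m \<times> words Y m"]) (auto simp: finite_words fin)
  have ST: "S a \<times> T b \<subseteq> Z" if "(a, b) \<in> D" for a b
  proof safe
    fix x y assume "x \<in> S a" "y \<in> T b"
    then have "conflicts Z (x # a) (y # b) \<noteq> 1"
      using Suc.prems(3) unfolding S_def T_def by blast
    then show "(x, y) \<in> Z"
      using that by (auto simp: D_def split: if_splits)
  qed
  have row: "card {p \<in> D. x \<in> S (fst p)} \<le> ?c" for x
  proof -
    let ?A = "{a \<in> words X m. x \<in> S a}"
    let ?B = "{b \<in> words Y m. \<exists>y\<in>T b. (x, y) \<in> Z}"
    have "card {p \<in> D. x \<in> S (fst p)} \<le> card {(a, b) \<in> ?A \<times> ?B. conflicts Z a b = 0}"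
    proof (rule card_mono)
      show "finite {(a, b) \<in> ?A \<times> ?B. conflicts Z a b = 0}"
        by (rule finite_subset[of _ "words X m \<times> words Y m"]) (auto simp: finite_words fin)
      show "{p \<in> D. x \<in> S (fst p)} \<subseteq> {(a, b) \<in> ?A \<times> ?B. conflicts Z a b = 0}"
        using ST by (fastforce simp: D_def)
    qed
    also have "\<dots> \<le> ?c"
    proof (rule Suc.IH)
      fix a b assume "a \<in> ?A" "b \<in> ?B"
      then obtain y where "x # a \<in> A" "y # b \<in> B" "(x, y) \<in> Z" by (auto simp: S_def T_def)
      then show "conflicts Z a b \<noteq> 1" using Suc.prems(3) by force
    qed auto
    finally show ?thesis .
  qed
  have col: "card {p \<in> D. y \<in> T (snd p)} \<le> ?c" for y
  proof -
    let ?A = "{a \<in> words X m. \<exists>x\<in>S a. (x, y) \<in> Z}"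
    let ?B = "{b \<in> words Y m. y \<in> T b}"
    have "card {p \<in> D. y \<in> T (snd p)} \<le> card {(a, b) \<in> ?A \<times> ?B. conflicts Z a b = 0}"
    proof (rule card_mono)
      show "finite {(a, b) \<in> ?A \<times> ?B. conflicts Z a b = 0}"
        by (rule finite_subset[of _ "words X m \<times> words Y m"]) (auto simp: finite_words fin)
      show "{p \<in> D. y \<in> T (snd p)} \<subseteq> {(a, b) \<in> ?A \<times> ?B. conflicts Z a b = 0}"
        using ST by (fastforce simp: D_def)
    qed
    also have "\<dots> \<le> ?c"
    proof (rule Suc.IH)
      fix a b assume "a \<in> ?A" "b \<in> ?B"
      then obtain x where "x # a \<in> A" "y # b \<in> B" "(x, y) \<in> Z" by (auto simp: S_def T_def)
      then show "conflicts Z a b \<noteq> 1" using Suc.prems(3) by force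
    qed auto
    finally show ?thesis .
  qed
  \<comment> \<open>Summing fibre sizes amounts to counting, for each letter, the pairs of tails it precedes.\<close>
  have swap: "(\<Sum>p\<in>D. card (F p)) \<le> card V * ?c"
    if "finite V" "\<And>p. F p \<subseteq> V" "\<And>v. card {p \<in> D. v \<in> F p} \<le> ?c" for F and V :: "'v set"
  proof -
    have "(\<Sum>p\<in>D. card (F p)) = (\<Sum>p\<in>D. card {v \<in> V. v \<in> F p})"
      using that(2) by (intro sum.cong arg_cong[where f = card]) auto
    also have "\<dots> = (\<Sum>v\<in>V. card {p \<in> D. v \<in> F p})"
      by (rule sum_multicount_gen[OF finD that(1)]) simp
    also have "\<dots> \<le> card V * ?c"
      using sum_bounded_above[of V "\<lambda>v. card {p \<in> D. v \<in> F p}" ?c] that(3) by simp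
    finally show ?thesis .
  qed
  have "{(a, b) \<in> A \<times> B. conflicts Z a b = 0}
      \<subseteq> (\<lambda>((a, b), (x, y)). (x # a, y # b)) ` (SIGMA p:D. S (fst p) \<times> T (snd p))"
  proof safe
    fix a b assume ab: "a \<in> A" "b \<in> B" "conflicts Z a b = 0"
    moreover obtain x a' where "a = x # a'" "a' \<in> words X m"
      using ab(1) Suc.prems(1) by (auto simp: words_Suc)
    moreover obtain y b' where "b = y # b'" "b' \<in> words Y m"
      using ab(2) Suc.prems(2) by (auto simp: words_Suc)
    ultimately have "((a', b'), (x, y)) \<in> (SIGMA p:D. S (fst p) \<times> T (snd p))"
      by (auto simp: D_def S_def T_def)
    then show "(a, b) \<in> (\<lambda>((a, b), (x, y)). (x # a, y # b)) ` (SIGMA p:D. S (fst p) \<times> T (snd p))"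
      using \<open>a = x # a'\<close> \<open>b = y # b'\<close> by force
  qed
  then have "card {(a, b) \<in> A \<times> B. conflicts Z a b = 0} \<le> card (SIGMA p:D. S (fst p) \<times> T (snd p))"
    by (rule surj_card_le[rotated]) (auto simp: finD finS finT)
  also have "\<dots> = (\<Sum>p\<in>D. card (S (fst p)) * card (T (snd p)))"
    by (simp add: finD finS finT card_cartesian_product)
  also have "\<dots> \<le> (\<Sum>p\<in>D. l * card (S (fst p)) + l * card (T (snd p)))"
  proof (rule sum_mono)
    fix p assume "p \<in> D"
    then have "card (S (fst p)) \<le> l \<or> card (T (snd p)) \<le> l"
      using ST[of "fst p" "snd p"] Z[OF S_sub T_sub] by simp
    then show "card (S (fst p)) * card (T (snd p)) \<le> l * card (S (fst p)) + l * card (T (snd p))"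
    proof
      assume "card (S (fst p)) \<le> l"
      then show ?thesis by (intro trans_le_add2 mult_le_mono1)
    next
      assume "card (T (snd p)) \<le> l"
      then show ?thesis by (subst (2) mult.commute) (intro trans_le_add1 mult_le_mono2)
    qed
  qed
  also have "\<dots> = l * ((\<Sum>p\<in>D. card (S (fst p))) + (\<Sum>p\<in>D. card (T (snd p))))"
    by (simp add: sum.distrib sum_distrib_left algebra_simps)
  also have "\<dots> \<le> l * (card X * ?c + card Y * ?c)"
    by (intro mult_le_mono2 add_mono swap) (auto intro: fin row col S_sub[THEN subsetD] T_sub[THEN subsetD])
  finally show ?case
    by (simp add: algebra_simps)
qed

lemma conflicts_unzip_eq_0:
  "set ps \<subseteq> Z \<Longrightarrow> conflicts Z (map fst ps) (map snd ps) = 0"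
  by (induction ps) auto

text \<open>Words over the alphabet \<open>Z\<close> unzip to conflict-free pairs of words.\<close>

lemma card_conflict_free_ge:
  assumes fin: "finite X" "finite Y" and Z: "Z \<subseteq> X \<times> Y"
  shows "card Z ^ m \<le> card {(a, b) \<in> words X m \<times> words Y m. conflicts Z a b = 0}"
proof -
  let ?f = "\<lambda>ps :: ('a \<times> 'b) list. (map fst ps, map snd ps)"
  have "finite Z" using Z fin finite_subset by blast
  have "inj ?f" by (rule injI) (metis Pair_inject zip_map_fst_snd)
  then have "card Z ^ m = card (?f ` words Z m)"
    using card_words[OF \<open>finite Z\<close>] by (metis card_image inj_on_subset subset_UNIV)
  also have "\<dots> \<le> card {(a, b) \<in> words X m \<times> words Y m. conflicts Z a b = 0}"
  proof (rule card_mono)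
    show "finite {(a, b) \<in> words X m \<times> words Y m. conflicts Z a b = 0}"
      by (rule finite_subset[of _ "words X m \<times> words Y m"]) (auto simp: finite_words fin)
    show "?f ` words Z m \<subseteq> {(a, b) \<in> words X m \<times> words Y m. conflicts Z a b = 0}"
      using Z by (fastforce simp: words_def conflicts_unzip_eq_0)
  qed
  finally show ?thesis .
qed

text \<open>The number of conflicts is a sum of \<open>m * card X\<close> products of a function of \<open>a\<close> and a function of \<open>b\<close>;
this is what keeps the rank of the matrix small.\<close>

lemma conflicts_eq_sum:
  assumes "finite X" "a \<in> words X m" "length b = m"
  shows "real (conflicts Z a b) = (\<Sum>(i, z)\<in>{..<m} \<times> X. of_bool (a ! i = z) * of_bool ((z, b ! i) \<notin> Z))"
proof -
  have "real (conflicts Z a b) = (\<Sum>i<m. of_bool ((a ! i, b ! i) \<notin> Z))"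
    using assms(2,3)
  proof (induction Z a b arbitrary: m rule: conflicts.induct)
    case (1 Z x xs y ys)
    then obtain k where m: "m = Suc k" by (auto simp: words_def)
    with 1 show ?case
      by (simp add: Cons_in_words_iff sum.lessThan_Suc_shift del: sum.lessThan_Suc)
  qed (auto simp: words_def)
  also have "\<dots> = (\<Sum>i<m. \<Sum>z\<in>X. of_bool (a ! i = z) * of_bool ((z, b ! i) \<notin> Z))"
  proof (rule sum.cong)
    fix i assume "i \<in> {..<m}"
    then have "a ! i \<in> X" using assms(2) by (auto simp: words_def)
    then show "of_bool ((a ! i, b ! i) \<notin> Z) = (\<Sum>z\<in>X. of_bool (a ! i = z) * of_bool ((z, b ! i) \<notin> Z) :: real)"
      using assms(1) by (simp add: of_bool_def if_distrib[of "\<lambda>t. t * _"] cong: if_cong)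
  qed simp
  finally show ?thesis by (simp add: sum.cartesian_product)
qed

section \<open>A dense relation without large grids\<close>

text \<open>Counting: for each of the at most \<open>q ^ (2 * l)\<close> grids \<open>S \<times> T\<close> with sides \<open>l = 2 * p + 1\<close>, a fraction
of \<open>2 / 2 ^ l\<^sup>2\<close> of all relations contains the grid or is disjoint from it. As
\<open>2 * p * l + 1 < l\<^sup>2\<close>, some relation does neither for any grid. Density then comes for free, since
it or its complement has at least half of all pairs.\<close>

lemma bipartite_ramsey:
  fixes p :: nat
  defines "q \<equiv> 2 ^ p"
  assumes "p \<ge> 1"
  shows "\<exists>Z \<subseteq> {..<q} \<times> {..<q}. q ^ 2 \<le> 2 * card Z \<and>
    (\<forall>S T. S \<subseteq> {..<q} \<longrightarrow> T \<subseteq> {..<q} \<longrightarrow> S \<times> T \<subseteq> Z \<longrightarrow> card S \<le> 2 * p \<or> card T \<le> 2 * p)"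
proof -
  define l where "l = 2 * p + 1"
  define G where "G = {..<q} \<times> {..<q}"
  define K where "K = {S. S \<subseteq> {..<q} \<and> card S = l}"
  have G: "finite G" "card G = q ^ 2" by (simp_all add: G_def card_cartesian_product power2_eq_square)
  define bad where "bad S T = {Z. S \<times> T \<subseteq> Z \<and> Z \<subseteq> G} \<union> {Z. Z \<subseteq> G - S \<times> T}" for S T
  have finbad: "finite (bad S T)" for S T
    by (rule finite_subset[of _ "Pow G"]) (auto simp: bad_def G)
  have finK: "finite K" by (simp add: K_def)
  have cardK: "card K \<le> q ^ l"
  proof -
    have "card K = q choose l"
      unfolding K_def using n_subsets[of "{..<q}" l] by simp
    then show ?thesis
      by (cases "l \<le> q") (simp_all add: binomial_le_pow binomial_eq_0)
  qed
  have card_bad: "card (bad S T) * 2 ^ l\<^sup>2 \<le> 2 * 2 ^ q\<^sup>2" if "S \<in> K" "T \<in> K" for S T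
  proof -
    have ST: "S \<times> T \<subseteq> G" "card (S \<times> T) = l\<^sup>2"
      using that by (auto simp: K_def G_def card_cartesian_product power2_eq_square)
    have diff: "card (G - S \<times> T) = q\<^sup>2 - l\<^sup>2"
      using ST G finite_subset by (metis card_Diff_subset)
    have "l\<^sup>2 \<le> q\<^sup>2" using card_mono[OF G(1) ST(1)] ST G by simp
    have "{Z. S \<times> T \<subseteq> Z \<and> Z \<subseteq> G} \<subseteq> (\<union>) (S \<times> T) ` Pow (G - S \<times> T)"
    proof
      fix Z assume "Z \<in> {Z. S \<times> T \<subseteq> Z \<and> Z \<subseteq> G}"
      then have "Z = S \<times> T \<union> (Z - S \<times> T)" "Z - S \<times> T \<in> Pow (G - S \<times> T)" by auto
      then show "Z \<in> (\<union>) (S \<times> T) ` Pow (G - S \<times> T)" by blast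
    qed
    then have "card {Z. S \<times> T \<subseteq> Z \<and> Z \<subseteq> G} \<le> card (Pow (G - S \<times> T))"
      by (rule surj_card_le[rotated]) (simp add: G)
    then have "card {Z. S \<times> T \<subseteq> Z \<and> Z \<subseteq> G} \<le> 2 ^ (q\<^sup>2 - l\<^sup>2)"
      using G diff by (simp add: card_Pow)
    moreover have "card {Z. Z \<subseteq> G - S \<times> T} = 2 ^ (q\<^sup>2 - l\<^sup>2)"
      using card_Pow[of "G - S \<times> T"] G diff by (simp add: Pow_def)
    ultimately have "card (bad S T) \<le> 2 * 2 ^ (q\<^sup>2 - l\<^sup>2)"
      unfolding bad_def using card_Un_le[of "{Z. S \<times> T \<subseteq> Z \<and> Z \<subseteq> G}" "{Z. Z \<subseteq> G - S \<times> T}"] by linarith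
    then have "card (bad S T) * 2 ^ l\<^sup>2 \<le> 2 * 2 ^ (q\<^sup>2 - l\<^sup>2) * 2 ^ l\<^sup>2" by (rule mult_le_mono1)
    also have "\<dots> = 2 * 2 ^ q\<^sup>2" using \<open>l\<^sup>2 \<le> q\<^sup>2\<close> by (simp flip: power_add)
    finally show ?thesis .
  qed
  have "card (\<Union>(S, T)\<in>K \<times> K. bad S T) * 2 ^ l\<^sup>2 \<le> (\<Sum>(S, T)\<in>K \<times> K. card (bad S T)) * 2 ^ l\<^sup>2"
    using card_UN_le[of "K \<times> K" "\<lambda>(S, T). bad S T"] finK by (intro mult_le_mono1) (simp add: case_prod_unfold)
  also have "\<dots> = (\<Sum>(S, T)\<in>K \<times> K. card (bad S T) * 2 ^ l\<^sup>2)"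
    by (simp add: sum_distrib_right case_prod_unfold)
  also have "\<dots> \<le> (\<Sum>(S, T)\<in>K \<times> K. 2 * 2 ^ q\<^sup>2)"
    by (rule sum_mono) (use card_bad in auto)
  also have "\<dots> = (card K)\<^sup>2 * (2 * 2 ^ q\<^sup>2)" by (simp add: card_cartesian_product power2_eq_square)
  also have "\<dots> \<le> (q ^ l)\<^sup>2 * (2 * 2 ^ q\<^sup>2)" by (intro mult_le_mono1 power_mono cardK) simp
  also have "\<dots> = 2 ^ (2 * p * l + 1) * 2 ^ q\<^sup>2"
    by (simp add: q_def power_mult[symmetric] power_add mult_ac)
  also have "\<dots> < 2 ^ l\<^sup>2 * 2 ^ q\<^sup>2"
  proof -
    have "2 * p * l + 1 < l\<^sup>2" using \<open>p \<ge> 1\<close> by (simp add: l_def power2_eq_square algebra_simps)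
    then have "2 ^ (2 * p * l + 1) < (2 :: nat) ^ l\<^sup>2" by (rule power_strict_increasing) simp
    then show ?thesis by (rule mult_strict_right_mono) simp
  qed
  finally have "card (\<Union>(S, T)\<in>K \<times> K. bad S T) < card (Pow G)"
    using G by (simp add: card_Pow)
  moreover have "finite (\<Union>(S, T)\<in>K \<times> K. bad S T)"
    using finK finbad by auto
  ultimately have "\<not> Pow G \<subseteq> (\<Union>(S, T)\<in>K \<times> K. bad S T)"
    using card_mono by (metis not_le)
  then obtain Z where Z: "Z \<subseteq> G" "\<And>S T. S \<in> K \<Longrightarrow> T \<in> K \<Longrightarrow> Z \<notin> bad S T"
    by blast
  \<comment> \<open>The relation and its complement are treated alike, as the larger one is chosen at the end.\<close>
  have no_grid: "card S \<le> 2 * p \<or> card T \<le> 2 * p"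
    if "S \<subseteq> {..<q}" "T \<subseteq> {..<q}" and sub: "S \<times> T \<subseteq> Z \<or> S \<times> T \<subseteq> G - Z" for S T
  proof (rule ccontr)
    assume "\<not> ?thesis"
    then have "l \<le> card S" "l \<le> card T" by (auto simp: l_def)
    then obtain S' T' where "S' \<subseteq> S" "card S' = l" "T' \<subseteq> T" "card T' = l"
      by (metis obtain_subset_with_card_n)
    then have "S' \<in> K" "T' \<in> K" "S' \<times> T' \<subseteq> S \<times> T" using that by (auto simp: K_def)
    then have "S' \<times> T' \<subseteq> Z \<or> Z \<subseteq> G - S' \<times> T'" using sub Z(1) by blast
    then have "Z \<in> bad S' T'" using Z(1) unfolding bad_def by blast
    then show False using Z(2) \<open>S' \<in> K\<close> \<open>T' \<in> K\<close> by blast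
  qed
  have "card Z + card (G - Z) = q\<^sup>2"
    using Z(1) G by (metis card_Diff_subset card_mono finite_subset le_add_diff_inverse)
  then consider "q\<^sup>2 \<le> 2 * card Z" | "q\<^sup>2 \<le> 2 * card (G - Z)" by linarith
  then show ?thesis
  proof cases
    case 1
    then show ?thesis using Z(1) no_grid unfolding G_def by blast
  next
    case 2
    then show ?thesis using no_grid unfolding G_def by (meson Diff_subset)
  qed
qed

section \<open>The matrix\<close>

text \<open>Rows and columns are the \<open>q ^ m\<close> words of length \<open>m\<close> over \<open>q\<close> letters, padded with zeros to size \<open>n\<close>,
and the entry at two words is \<open>(1 - conflicts)\<^sup>2\<close>. It vanishes exactly if they have one conflict, so rectangles
in the support satisfy the hypothesis of \<open>card_conflict_free_in_rectangle_le\<close>. The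
\<open>(card Z) ^ m \<ge> (q\<^sup>2 / 2) ^ m\<close> conflict-free pairs are thus covered by pieces of size at most
\<open>(4 * p * q) ^ m\<close>.\<close>

lemma mat_with_small_rank_large_nonneg_rank:
  fixes m n p :: nat
  defines "q \<equiv> 2 ^ p"
  assumes "p \<ge> 1" and n: "q ^ m \<le> n"
  obtains M where "M \<in> carrier_mat n n" "nonneg_mat M" "mat_rank M \<ge> 1"
    "mat_rank M \<le> (1 + m * q)\<^sup>2" "(real q / (8 * real p)) ^ m \<le> real (nonneg_rank M)"
proof -
  obtain Z where Z: "Z \<subseteq> {..<q} \<times> {..<q}" and cardZ: "q\<^sup>2 \<le> 2 * card Z"
    and grid: "\<And>S T. S \<subseteq> {..<q} \<Longrightarrow> T \<subseteq> {..<q} \<Longrightarrow> S \<times> T \<subseteq> Z \<Longrightarrow> card S \<le> 2 * p \<or> card T \<le> 2 * p"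
    using bipartite_ramsey[OF \<open>p \<ge> 1\<close>] unfolding q_def by blast
  define N where "N = q ^ m"
  let ?w = "words {..<q} m"
  have "q > 0" by (simp add: q_def)
  obtain e where e: "bij_betw e {..<N} ?w"
    using ex_bij_betw_nat_finite[OF finite_words[of "{..<q}" m]] card_words[of "{..<q}" m]
    by (auto simp: N_def atLeast0LessThan)
  have ew: "e i \<in> ?w" if "i < N" for i using e that by (auto simp: bij_betw_def)
  define h where "h i j = 1 - real (conflicts Z (e i) (e j))" for i j
  define M where "M = mat n n (\<lambda>(i, j). if i < N \<and> j < N then (h i j)\<^sup>2 else 0)"
  have dim: "M \<in> carrier_mat n n" "dim_row M = n" "dim_col M = n" by (simp_all add: M_def)
  have nn: "nonneg_mat M" by (auto simp: nonneg_mat_def M_def)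
  have M_nz_iff: "M $$ (i, j) \<noteq> 0 \<longleftrightarrow> i < N \<and> j < N \<and> conflicts Z (e i) (e j) \<noteq> 1" if "i < n" "j < n" for i j
    using that by (auto simp: M_def h_def)

  \<comment> \<open>The index \<open>None\<close> stands for the constant 1 and \<open>Some (r, z)\<close> for the letter \<open>z\<close> at position \<open>r\<close>;
    squaring the sum over \<open>K\<close> gives products indexed by \<open>K \<times> K\<close>.\<close>
  define K where "K = insert None (Some ` ({..<m} \<times> {..<q}))"
  have finK: "finite K" and cardK: "card K = 1 + m * q"
    by (simp_all add: K_def card_image card_cartesian_product card.insert_remove)
  define f :: "(nat \<times> nat) option \<Rightarrow> nat \<Rightarrow> real" where
    "f k i = (case k of None \<Rightarrow> 1 | Some (r, z) \<Rightarrow> - of_bool (e i ! r = z))" for k i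
  define g :: "(nat \<times> nat) option \<Rightarrow> nat \<Rightarrow> real" where
    "g k j = (case k of None \<Rightarrow> 1 | Some (r, z) \<Rightarrow> of_bool ((z, e j ! r) \<notin> Z))" for k j
  have h_sum: "h i j = (\<Sum>k\<in>K. f k i * g k j)" if "i < N" "j < N" for i j
  proof -
    have "(\<Sum>k\<in>K. f k i * g k j) = 1 + (\<Sum>k\<in>{..<m} \<times> {..<q}. f (Some k) i * g (Some k) j)"
      by (simp add: K_def sum.reindex f_def g_def)
    also have "\<dots> = 1 - (\<Sum>(r, z)\<in>{..<m} \<times> {..<q}. of_bool (e i ! r = z) * of_bool ((z, e j ! r) \<notin> Z))"
      by (simp add: f_def g_def case_prod_unfold sum_negf)
    also have "\<dots> = h i j"
      using conflicts_eq_sum[of "{..<q}" "e i" m "e j" Z] ew[OF that(1)] ew[OF that(2)]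
      by (simp add: h_def words_def)
    finally show ?thesis by simp
  qed
  let ?u = "\<lambda>(k, k') i. of_bool (i < N) * (f k i * f k' i)"
  let ?v = "\<lambda>(k, k') j. of_bool (j < N) * (g k j * g k' j)"
  have "M = mat n n (\<lambda>(i, j). \<Sum>kk\<in>K \<times> K. ?u kk i * ?v kk j)"
  proof (rule eq_matI)
    fix i j assume "i < dim_row (mat n n (\<lambda>(i, j). \<Sum>kk\<in>K \<times> K. ?u kk i * ?v kk j))"
      "j < dim_col (mat n n (\<lambda>(i, j). \<Sum>kk\<in>K \<times> K. ?u kk i * ?v kk j))"
    then have ij: "i < n" "j < n" by auto
    have "M $$ (i, j) = (\<Sum>kk\<in>K \<times> K. ?u kk i * ?v kk j)"
    proof (cases "i < N \<and> j < N")
      case True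
      then have "M $$ (i, j) = (\<Sum>k\<in>K. f k i * g k j) * (\<Sum>k\<in>K. f k i * g k j)"
        using ij h_sum by (simp add: M_def power2_eq_square)
      also have "\<dots> = (\<Sum>(k, k')\<in>K \<times> K. f k i * g k j * (f k' i * g k' j))"
        by (simp add: sum_product sum.cartesian_product)
      also have "\<dots> = (\<Sum>kk\<in>K \<times> K. ?u kk i * ?v kk j)"
        using True by (intro sum.cong) (auto simp: mult_ac)
      finally show ?thesis .
    next
      case False
      then show ?thesis using ij by (auto simp: M_def case_prod_unfold)
    qed
    then show "M $$ (i, j) = mat n n (\<lambda>(i, j). \<Sum>kk\<in>K \<times> K. ?u kk i * ?v kk j) $$ (i, j)"
      using ij by simp
  qed (simp_all add: M_def)
  then have rank_le: "mat_rank M \<le> (1 + m * q)\<^sup>2"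
    using mat_rank_sum_products_le[of "K \<times> K" n n ?u ?v] finK cardK
    by (simp add: card_cartesian_product power2_eq_square)

  define D where "D = {(i, j). i < N \<and> j < N \<and> conflicts Z (e i) (e j) = 0}"
  have inj: "inj_on (map_prod e e) ({..<N} \<times> {..<N})"
    using e by (intro map_prod_inj_on) (auto simp: bij_betw_def)
  have D_sub: "D \<subseteq> {..<N} \<times> {..<N}" by (auto simp: D_def)
  have "{(a, b) \<in> ?w \<times> ?w. conflicts Z a b = 0} \<subseteq> map_prod e e ` D"
  proof
    fix ab assume "ab \<in> {(a, b) \<in> ?w \<times> ?w. conflicts Z a b = 0}"
    then obtain a b where ab: "ab = (a, b)" "a \<in> e ` {..<N}" "b \<in> e ` {..<N}" "conflicts Z a b = 0"
      using bij_betw_imp_surj_on[OF e] by auto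
    then obtain i j where "a = e i" "b = e j" "(i, j) \<in> D" by (auto simp: D_def)
    then show "ab \<in> map_prod e e ` D" using ab(1) by force
  qed
  then have "card {(a, b) \<in> ?w \<times> ?w. conflicts Z a b = 0} \<le> card D"
    by (rule surj_card_le[rotated]) (rule finite_subset[OF D_sub], simp)
  then have D_ge: "card Z ^ m \<le> card D"
    using card_conflict_free_ge[OF _ _ Z, of m] by simp
  have "card D \<le> nonneg_rank M * (2 * p * (card {..<q} + card {..<q})) ^ m"
  proof (rule card_le_nonneg_rank_mult[OF nn])
    show "D \<subseteq> {..<dim_row M} \<times> {..<dim_col M}"
      using D_sub n by (auto simp: dim N_def)
    show "M $$ (i, j) \<noteq> 0" if "(i, j) \<in> D" for i j
      using that M_nz_iff[of i j] n by (auto simp: D_def N_def)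
  next
    fix I J
    assume IJ: "I \<subseteq> {..<dim_row M}" "J \<subseteq> {..<dim_col M}"
      and nz: "\<And>i j. i \<in> I \<Longrightarrow> j \<in> J \<Longrightarrow> M $$ (i, j) \<noteq> 0"
    let ?A = "e ` (I \<inter> {..<N})" and ?B = "e ` (J \<inter> {..<N})"
    have "card (D \<inter> I \<times> J) = card (map_prod e e ` (D \<inter> I \<times> J))"
      using D_sub by (intro card_image[symmetric] inj_on_subset[OF inj]) auto
    also have "\<dots> \<le> card {(a, b) \<in> ?A \<times> ?B. conflicts Z a b = 0}"
    proof (rule card_mono)
      show "finite {(a, b) \<in> ?A \<times> ?B. conflicts Z a b = 0}"
        by (rule finite_subset[of _ "?A \<times> ?B"]) auto
      show "map_prod e e ` (D \<inter> I \<times> J) \<subseteq> {(a, b) \<in> ?A \<times> ?B. conflicts Z a b = 0}"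
        by (auto simp: D_def)
    qed
    also have "\<dots> \<le> (2 * p * (card {..<q} + card {..<q})) ^ m"
    proof (rule card_conflict_free_in_rectangle_le[OF _ _ grid])
      show "?A \<subseteq> ?w" "?B \<subseteq> ?w" using ew by auto
      fix a b assume "a \<in> ?A" "b \<in> ?B"
      then obtain i j where "a = e i" "b = e j" "i \<in> I" "j \<in> J" by auto
      moreover from this have "i < n" "j < n" using IJ by (auto simp: dim)
      ultimately show "conflicts Z a b \<noteq> 1"
        using nz[of i j] M_nz_iff[of i j] by auto
    qed auto
    finally show "card (D \<inter> I \<times> J) \<le> (2 * p * (card {..<q} + card {..<q})) ^ m" .
  qed
  moreover have "2 * p * (card {..<q} + card {..<q}) = 4 * p * q" by simp
  ultimately have "card Z ^ m \<le> nonneg_rank M * (4 * p * q) ^ m"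
    using D_ge by (metis order_trans)
  then have "real (card Z) ^ m \<le> real (nonneg_rank M) * (4 * real p * real q) ^ m"
    by (metis (mono_tags) of_nat_le_iff of_nat_mult of_nat_numeral of_nat_power)
  moreover have "(real q * real q / 2) ^ m \<le> real (card Z) ^ m"
  proof (rule power_mono)
    have "real (q\<^sup>2) \<le> real (2 * card Z)" using cardZ by (simp only: of_nat_le_iff)
    then show "real q * real q / 2 \<le> real (card Z)" by (simp add: power2_eq_square)
  qed simp
  ultimately have "(real q * real q / 2) ^ m / (4 * real p * real q) ^ m \<le> real (nonneg_rank M)"
    using \<open>q > 0\<close> \<open>p \<ge> 1\<close> by (subst pos_divide_le_eq) auto
  moreover have "(real q * real q / 2) ^ m / (4 * real p * real q) ^ m = (real q / (8 * real p)) ^ m"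
    using \<open>q > 0\<close> \<open>p \<ge> 1\<close> by (simp flip: power_divide)
  ultimately have nnr: "(real q / (8 * real p)) ^ m \<le> real (nonneg_rank M)" by simp

  have "card Z > 0" using cardZ \<open>q > 0\<close> by (cases "card Z") auto
  then have "card D > 0" using D_ge by (metis less_le_trans zero_less_power)
  then obtain i j where "(i, j) \<in> D" by (metis card.empty equals0I less_irrefl surj_pair)
  then have "mat_rank M \<ge> 1"
    using mat_rank_pos[OF dim(1), of i j] M_nz_iff[of i j] n by (auto simp: D_def N_def)
  then show thesis using that dim(1) nn rank_le nnr by blast
qed

section \<open>Choice of the parameters\<close>

text \<open>Here \<open>L\<close> is the binary logarithm of the size, and the right-hand side is that of
\<open>(q / (8 * p)) ^ m / (2 ^ m * q)\<^sup>2\<close> with \<open>q = 2 powr p\<close>. Rounding \<open>L / p\<close> to an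
integer costs \<open>p\<close>, the rank costs \<open>2 * p + 2 * m\<close>, and the covering bound costs \<open>m * log 2 (8 * p)\<close>, which is
\<open>O(L / p * log 2 L)\<close>. The choice \<open>p \<approx> sqrt (L * log 2 L)\<close> balances them. The constant collects
\<open>3 + 6\<close> from the multiples of \<open>p \<le> 3 * s\<close>, \<open>11\<close> from the logarithm and \<open>4\<close> from \<open>2 * m\<close>.\<close>

lemma exponent_loss_le:
  fixes L m p :: real
  defines "s \<equiv> sqrt (L * log 2 L)"
  assumes L: "L \<ge> 3 / 2"
    and p: "s \<le> p" "p \<le> s + 1" and m: "0 \<le> m" "m \<le> L / p" "L / p \<le> m + 1"
  shows "L - 24 * s \<le> m * p - m * log 2 (8 * p) - 2 * p - 2 * m"
proof -
  let ?K = "log 2 L"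
  \<comment> \<open>The lower bound \<open>3 / 2\<close> on \<open>L\<close> keeps \<open>log 2 L\<close> away from 0, so that additive constants can be absorbed.\<close>
  have K: "?K \<ge> 1 / 2"
  proof -
    have "2 powr (1 / 2) \<le> (3 / 2 :: real)"
    proof -
      have "sqrt 2 \<le> 3 / 2" by (rule real_le_lsqrt) (simp_all add: power2_eq_square)
      then show ?thesis by (simp add: powr_half_sqrt)
    qed
    also note L
    finally show ?thesis using L by (subst le_log_iff) auto
  qed
  have s_sq: "s * s = L * ?K" using L K by (simp add: s_def)
  have "1 / 2 * (1 / 2) \<le> L * ?K" using L K by (intro mult_mono) auto
  then have s_ge: "s \<ge> 1 / 2"
    unfolding s_def by (intro real_le_rsqrt) (simp add: power2_eq_square)
  have "?K \<le> L"
  proof -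
    have "ln (L / 2) \<le> L / 2 - 1" using L by (intro ln_le_minus_one) auto
    then have "ln L \<le> L / 2" using L ln2_le_25_over_36 by (simp add: ln_div)
    also have "\<dots> \<le> L * ln 2" using L ln2_ge_two_thirds by simp
    finally show ?thesis by (simp add: log_def pos_divide_le_eq)
  qed
  then have "s * s \<le> L * L" unfolding s_sq by (rule mult_left_mono) (use L in simp)
  then have "s\<^sup>2 \<le> L\<^sup>2" by (simp only: power2_eq_square)
  then have "s \<le> L" by (rule power2_le_imp_le) (use L in simp)
  have "p > 0" "p \<le> 3 * s" using p s_ge by auto
  have m_K: "m * ?K \<le> s"
  proof -
    have "L / p \<le> L / s" using p(1) s_ge L by (intro divide_left_mono) auto
    with m(2) have "m \<le> L / s" by simp
    then have "m * ?K \<le> L / s * ?K" using K by (intro mult_right_mono) auto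
    also have "\<dots> = s" using s_sq s_ge by (simp add: field_simps)
    finally show ?thesis .
  qed
  have "log 2 (8 * p) \<le> log 2 (2 ^ 5 * L)"
    using \<open>p > 0\<close> \<open>p \<le> 3 * s\<close> \<open>s \<le> L\<close> L by (intro log_mono) auto
  also have "\<dots> = log 2 (2 ^ 5) + ?K" using L by (subst log_mult) auto
  also have "\<dots> = 5 + ?K" by (subst log_pow_cancel) auto
  also have "\<dots> \<le> 11 * ?K" using K by simp
  finally have "m * log 2 (8 * p) \<le> m * (11 * ?K)" using m(1) by (rule mult_left_mono)
  moreover have "m * (1 / 2) \<le> m * ?K" using m(1) K by (intro mult_left_mono) auto
  moreover have "L \<le> m * p + p" using m(3) \<open>p > 0\<close> by (simp add: pos_divide_le_eq algebra_simps)
  ultimately show ?thesis using m_K \<open>p \<le> 3 * s\<close> by linarith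
qed

theorem theorem13:
  shows "\<exists>C::real. C > 0 \<and>
    (\<forall>n::nat. n \<ge> 3 \<longrightarrow>
      (\<exists>M::real mat. M \<in> carrier_mat n n \<and> M \<noteq> 0\<^sub>m n n \<and> nonneg_mat M \<and>
        real (nonneg_rank M) / real (mat_rank M)
          \<ge> real n powr (1 - C * sqrt (log 2 (log 2 (real n)) / log 2 (real n)))))"
proof (intro exI[of _ 24] conjI allI impI)
  fix n :: nat assume n: "n \<ge> 3"
  define L where "L = log 2 (real n)"
  define s where "s = sqrt (L * log 2 L)"
  define p where "p = nat \<lceil>s\<rceil>"
  define m where "m = nat \<lfloor>L / p\<rfloor>"
  have L: "L \<ge> 3 / 2"
  proof -
    have "(2 powr (3 / 2)) ^ 2 \<le> (3 :: real) ^ 2"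
      by (simp add: powr_power)
    then have "2 powr (3 / 2) \<le> (3 :: real)"
      by (rule power2_le_imp_le) simp
    also have "3 \<le> real n" using n by simp
    finally show ?thesis using n unfolding L_def by (subst le_log_iff) auto
  qed
  have "s > 0" unfolding s_def using L by (auto intro!: mult_pos_pos)
  then have "p \<ge> 1" by (simp add: p_def Suc_le_eq)
  have p: "s \<le> real p" "real p \<le> s + 1" using \<open>s > 0\<close> by (simp_all add: p_def)
  have "L / p \<ge> 0" using L by simp
  then have m: "real m \<le> L / p" "L / p \<le> real m + 1" by (simp_all add: m_def)
  define q :: nat where "q = 2 ^ p"
  have q: "real q = 2 powr p" by (simp add: q_def powr_realpow)
  have "real (q ^ m) = 2 powr (real m * real p)"
    by (simp add: q powr_power mult.commute)
  also have "\<dots> \<le> 2 powr L"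
    using m(1) \<open>p \<ge> 1\<close> by (simp add: pos_le_divide_eq)
  also have "\<dots> = real n" using n by (simp add: L_def)
  finally have "q ^ m \<le> n" by simp
  then obtain M where M: "M \<in> carrier_mat n n" "nonneg_mat M" "mat_rank M \<ge> 1"
    "mat_rank M \<le> (1 + m * q)\<^sup>2" "(real q / (8 * real p)) ^ m \<le> real (nonneg_rank M)"
    using mat_with_small_rank_large_nonneg_rank[OF \<open>p \<ge> 1\<close>] unfolding q_def by metis
  \<comment> \<open>The square root of the rank bound is replaced by a power of two.\<close>
  have "1 + m * q \<le> 2 ^ m * q"
  proof -
    have "Suc m \<le> 2 ^ m" by (rule Suc_leI) (rule less_exp)
    then have "Suc m * q \<le> 2 ^ m * q" by (rule mult_le_mono1)
    moreover have "1 \<le> q" by (simp add: q_def)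
    ultimately show ?thesis by simp
  qed
  then have "mat_rank M \<le> (2 ^ m * q)\<^sup>2"
    by (intro order_trans[OF M(4)] power_mono) simp_all
  then have "real (mat_rank M) \<le> real ((2 ^ m * q)\<^sup>2)"
    by (simp only: of_nat_le_iff)
  also have "\<dots> = (2 ^ m * real q)\<^sup>2" by simp
  also have "2 ^ m * real q = 2 powr (real m + real p)"
    by (simp add: q powr_add powr_realpow)
  also have "(2 powr (real m + real p))\<^sup>2 = 2 powr (2 * real p + 2 * real m)"
    by (simp add: powr_power algebra_simps)
  finally have rank: "real (mat_rank M) \<le> 2 powr (2 * real p + 2 * real m)" .
  have "real n powr (1 - 24 * sqrt (log 2 L / L)) = 2 powr (L * (1 - 24 * sqrt (log 2 L / L)))"
    using n by (simp add: L_def powr_powr flip: powr_powr)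
  also have "L * (1 - 24 * sqrt (log 2 L / L)) = L - 24 * s"
  proof -
    have "L * sqrt (log 2 L / L) = sqrt (L * L) * sqrt (log 2 L / L)" using L by simp
    also have "\<dots> = sqrt (L * L * (log 2 L / L))" by (simp only: real_sqrt_mult)
    also have "L * L * (log 2 L / L) = L * log 2 L" using L by simp
    also have "sqrt (L * log 2 L) = s" by (simp only: s_def)
    finally show ?thesis by (simp add: algebra_simps)
  qed
  also have "2 powr (L - 24 * s) \<le> 2 powr (real m * real p - real m * log 2 (8 * real p) - 2 * real p - 2 * real m)"
    using exponent_loss_le[OF L, of p m] p m by (simp add: s_def)
  also have "\<dots> = (2 powr (real p - log 2 (8 * real p))) ^ m / 2 powr (2 * real p + 2 * real m)"
    by (simp add: powr_power algebra_simps flip: powr_diff)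
  also have "2 powr (real p - log 2 (8 * real p)) = real q / (8 * real p)"
    using \<open>p \<ge> 1\<close> by (simp add: powr_diff q)
  also have "(real q / (8 * real p)) ^ m / 2 powr (2 * real p + 2 * real m) \<le> real (nonneg_rank M) / real (mat_rank M)"
    using M(3,5) rank by (intro frac_le) auto
  finally have "real n powr (1 - 24 * sqrt (log 2 L / L)) \<le> real (nonneg_rank M) / real (mat_rank M)" .
  moreover have "M \<noteq> 0\<^sub>m n n"
    using M(3) vec_space.rank_0I[of n n, where 'a=real] by (auto simp: mat_rank_def)
  ultimately show "\<exists>M. M \<in> carrier_mat n n \<and> M \<noteq> 0\<^sub>m n n \<and> nonneg_mat M \<and>
      real n powr (1 - 24 * sqrt (log 2 (log 2 (real n)) / log 2 (real n))) \<le> real (nonneg_rank M) / real (mat_rank M)"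
    using M(1,2) unfolding L_def by blast
qed simp

end
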